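(* Assume that $V$ satisfies (A-i)–(A-iii) and that the reference trajectory satisfies the uniform bound (B) with constants $\bar c\ge\underline c>0$ (notation in the context). Let $\lambda_{\min}$ and $\lambda_{\max}$ be the minimum and maximum eigenvalues of the operator $\nabla^2V(I)$ restricted to $\mathfrak{g}^\perp$. If $$0<\alpha h<\frac{2\lambda_{\min}\,\underline c^{\,2}}{\lambda_{\max}^2\,\bar c},$$ then the discrete-time linear time-varying system on $\mathfrak{g}^\perp$ $$\delta g^\perp_{k+1}=\delta g^\perp_k-h\alpha\Big(\big(\nabla^2V(I)\cdot\delta g^\perp_k\big)\big(g_{0,k}g_{0,k}^\top\big)^{-1}\Big)^\perp$$ is exponentially stable to zero.
   Context: $G\subset\mathbb{R}^{n\times n}$ is a matrix Lie group with identity $I$ and Lie algebra $\mathfrak{g}\subset\mathbb{R}^{n\times n}$. $\mathbb{R}^{n\times n}$ carries the inner product $\langle A,B\rangle=\operatorname{trace}(A^\top B)$; $\mathfrak{g}^\perp$ is the orthogonal complement of $\mathfrak{g}$ and $v\mapsto v^\perp\in\mathfrak{g}^\perp$ the orthogonal projection. $V:\mathbb{R}^{n\times n}\to[0,\infty)$ is a $C^2$ function. The assumptions on $V$ are: (A-i) $V^{-1}(0)=G$; (A-ii) $V(xg)=V(x)$ for all $x\in\mathbb{R}^{n\times n}$, $g\in G$; (A-iii) $\nabla^2V(I)\cdot(y,y)>0$ for all $y\in\mathfrak{g}^\perp\setminus\{0\}$. The Hessian $\nabla^2V(I)$ is also viewed as the self-adjoint operator $v\mapsto\nabla^2V(I)\cdot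 v$ on $\mathbb{R}^{n\times n}$ with $\langle w,\nabla^2V(I)\cdot v\rangle=\nabla^2V(I)\cdot(w,v)$; under these assumptions it maps $\mathfrak{g}^\perp$ into itself. $t\mapsto g_0(t)\in G$ is the group component of a reference trajectory, $g_{0,k}:=g_0(kh)$, where $h>0$ is the discretization step; $\alpha>0$ is a constant. Condition (B): $\underline c\,I\preceq g_0(t)g_0(t)^\top\preceq\bar c\,I$ for all $t$. Exponentially stable to zero means: there are $C>0$, $\rho\in[0,1)$ such that every solution satisfies $\|\delta g^\perp_k\|\le C\rho^{k-k_0}\|\delta g^\perp_{k_0}\|$ for all $k\ge k_0$. *)

theory Defs
  imports "HOL-Analysis.Analysis"
begin

(* A matrix Lie group is a subgroup of GL(n,R) that is closed in GL(n,R); it need not be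
   closed in the space of all matrices. *)
definition matrix_Lie_group :: "(real^'n^'n) set \<Rightarrow> bool" where
  "matrix_Lie_group G \<longleftrightarrow>
     G \<subseteq> {A. invertible A} \<and> mat 1 \<in> G \<and>
     (\<forall>A\<in>G. \<forall>B\<in>G. A ** B \<in> G) \<and> (\<forall>A\<in>G. matrix_inv A \<in> G) \<and>
     closedin (top_of_set {A. invertible A}) G"

(* The tangent space at the identity: velocities at time 0 of curves in G through mat 1.
   The Lie bracket is not needed here. *)
definition Lie_algebra :: "(real^'n^'n) set \<Rightarrow> (real^'n^'n) set" where
  "Lie_algebra G =
     {X. \<exists>\<gamma> e. 0 < e \<and> \<gamma> C1_differentiable_on {-e<..<e} \<and> \<gamma> ` {-e<..<e} \<subseteq> G \<and>
           \<gamma> 0 = mat 1 \<and> (\<gamma> has_vector_derivative X) (at 0)}"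

(* The library's inner product on matrices is the Frobenius one, and the norm it induces is the
   Frobenius norm. *)
lemma inner_matrix_eq_trace: "inner A B = trace (transpose A ** B)" for A B :: "real^'n^'n"
proof -
  have "trace (transpose A ** B) = (\<Sum>j\<in>UNIV. \<Sum>i\<in>UNIV. A$i$j * B$i$j)"
    by (simp add: trace_def matrix_matrix_mult_def transpose_def)
  also have "\<dots> = (\<Sum>i\<in>UNIV. \<Sum>j\<in>UNIV. A$i$j * B$i$j)"
    by (rule sum.swap)
  finally show ?thesis by (simp add: inner_vec_def)
qed

definition orth_proj :: "'a::real_inner set \<Rightarrow> 'a \<Rightarrow> 'a" where
  "orth_proj W v = (THE p. p \<in> W \<and> v - p \<in> orthogonal_comp W)"

lemma orth_proj_unique:
  fixes v :: "'a::real_inner"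
  assumes W: "subspace W" and p: "p \<in> W" "v - p \<in> orthogonal_comp W"
  shows "orth_proj W v = p"
  unfolding orth_proj_def
proof (rule the_equality)
  fix q assume q: "q \<in> W \<and> v - q \<in> orthogonal_comp W"
  have "q - p \<in> W" using W p q by (simp add: subspace_diff)
  moreover have "(v - p) - (v - q) \<in> orthogonal_comp W"
    using p q by (blast intro: subspace_diff subspace_orthogonal_comp)
  ultimately have "orthogonal (q - p) (q - p)" by (simp add: orthogonal_comp_def)
  then show "q = p" by (simp add: orthogonal_self)
qed (use p in blast)

definition C2 :: "('a::real_normed_vector \<Rightarrow> real) \<Rightarrow> bool" where
  "C2 f \<longleftrightarrow>
     (\<exists>(f' :: 'a \<Rightarrow> 'a \<Rightarrow>\<^sub>L real) (f'' :: 'a \<Rightarrow> 'a \<Rightarrow>\<^sub>L 'a \<Rightarrow>\<^sub>L real).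
        (\<forall>x. (f has_derivative blinfun_apply (f' x)) (at x)) \<and>
        (\<forall>x. (f' has_derivative blinfun_apply (f'' x)) (at x)) \<and>
        continuous_on UNIV f'')"

(* The second derivative as a bilinear form: differentiate in direction v, then in direction w. *)
definition hessian_form :: "('a::real_normed_vector \<Rightarrow> real) \<Rightarrow> 'a \<Rightarrow> 'a \<Rightarrow> 'a \<Rightarrow> real" where
  "hessian_form f x w v = frechet_derivative (\<lambda>z. frechet_derivative f (at z) v) (at x) w"

definition hessian_op :: "('a::real_inner \<Rightarrow> real) \<Rightarrow> 'a \<Rightarrow> 'a \<Rightarrow> 'a" where
  "hessian_op f x v = (THE u. \<forall>w. inner w u = hessian_form f x w v)"

lemma C2_hessian:
  assumes "C2 f"
  obtains f' f''
  where "\<And>x. (f has_derivative blinfun_apply (f' x)) (at x)"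
    and "\<And>x. (f' has_derivative blinfun_apply (f'' x)) (at x)"
    and "continuous_on UNIV f''"
    and "\<And>x w v. hessian_form f x w v = blinfun_apply (blinfun_apply (f'' x) w) v"
proof -
  obtain f' f''
    where f': "\<And>x. (f has_derivative blinfun_apply (f' x)) (at x)"
      and f'': "\<And>x. (f' has_derivative blinfun_apply (f'' x)) (at x)"
      and cont: "continuous_on UNIV f''"
    using assms unfolding C2_def by blast
  have fd: "frechet_derivative f (at z) = blinfun_apply (f' z)" for z
    using frechet_derivative_at[OF f'] by simp
  have "((\<lambda>z. blinfun_apply (f' z) v) has_derivative
      (\<lambda>w. blinfun_apply (blinfun_apply (f'' x) w) v)) (at x)" for x v
    using f'' by (auto intro!: derivative_eq_intros simp: blinfun.bilinear_simps)
  from frechet_derivative_at[OF this]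
  have "hessian_form f x w v = blinfun_apply (blinfun_apply (f'' x) w) v" for x w v
    unfolding hessian_form_def fd by metis
  then show thesis using that f' f'' cont by blast
qed

lemma inner_hessian_op:
  fixes f :: "'a::euclidean_space \<Rightarrow> real"
  assumes "C2 f"
  shows "inner w (hessian_op f x v) = hessian_form f x w v"
proof -
  obtain f' f''
    where H: "\<And>x w v. hessian_form f x w v =
        blinfun_apply (blinfun_apply (f'' x :: 'a \<Rightarrow>\<^sub>L 'a \<Rightarrow>\<^sub>L real) w) v"
    using C2_hessian[OF assms] by metis
  have lin: "linear (\<lambda>w. hessian_form f x w v)"
    unfolding H by (intro linearI) (simp_all add: blinfun.bilinear_simps)
  define u where "u = adjoint (\<lambda>w. hessian_form f x w v) 1"
  have u: "\<forall>w. inner w u = hessian_form f x w v"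
    using adjoint_works[OF lin, of _ 1] by (simp add: u_def)
  have "hessian_op f x v = u"
    unfolding hessian_op_def
  proof (rule the_equality[where P = "\<lambda>u. \<forall>w. inner w u = hessian_form f x w v", OF u])
    fix u' assume "\<forall>w. inner w u' = hessian_form f x w v"
    with u show "u' = u" by (metis vector_eq_ldot)
  qed
  with u show ?thesis by blast
qed

definition eigenvalues_on :: "('a::real_vector \<Rightarrow> 'a) \<Rightarrow> 'a set \<Rightarrow> real set" where
  "eigenvalues_on T W = {\<mu>. \<exists>v\<in>W. v \<noteq> 0 \<and> T v = \<mu> *\<^sub>R v}"

definition psd :: "real^'n^'n \<Rightarrow> bool" where
  "psd A \<longleftrightarrow> transpose A = A \<and> (\<forall>x. 0 \<le> inner x (A *v x))"

definition loewner_le :: "real^'n^'n \<Rightarrow> real^'n^'n \<Rightarrow> bool" where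
  "loewner_le A B \<longleftrightarrow> psd (B - A)"

(* Exponential stability to zero of x(k+1) = F k (x k) on W, with constants uniform in the initial
   time k0. Solutions need only exist from k0 onwards, as F k need not be invertible. *)
definition exponentially_stable :: "'a::real_normed_vector set \<Rightarrow> (nat \<Rightarrow> 'a \<Rightarrow> 'a) \<Rightarrow> bool" where
  "exponentially_stable W F \<longleftrightarrow>
     (\<exists>C>0. \<exists>\<rho>. 0 \<le> \<rho> \<and> \<rho> < 1 \<and>
        (\<forall>k0 x. (\<forall>k\<ge>k0. x k \<in> W \<and> x (Suc k) = F k (x k)) \<longrightarrow>
           (\<forall>k\<ge>k0. norm (x k) \<le> C * \<rho> ^ (k - k0) * norm (x k0))))"

end

theory Submission
  imports Defs
begin

text \<open>The gradient of \<open>V\<close> vanishes along \<open>G\<close>, so the Hessian \<open>H\<close> at the identity annihilates the Lie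
  algebra and, being self-adjoint, takes values in its orthogonal complement \<open>W\<close>. Hence \<open>x \<mapsto> \<langle>x, H x\<rangle>\<close>
  is a Lyapunov function on \<open>W\<close>: with \<open>p = (H x N)\<^sup>\<bottom>\<close> and \<open>N = (g g\<^sup>T)\<^sup>-\<^sup>1\<close>, its first variation
  satisfies \<open>\<langle>H x, p\<rangle> = \<langle>H x, H x N\<rangle> \<ge> |H x|\<^sup>2 / c_hi\<close>, while \<open>\<langle>p, H p\<rangle> \<le> lam_max |H x|\<^sup>2 / c_lo\<^sup>2\<close>.\<close>

section \<open>Symmetry of second derivatives and their vanishing along minimizers\<close>

text \<open>The mean value theorem is applied twice: along \<open>u\<close> to the increment
  \<open>\<phi>\<close> of \<open>f\<close> across \<open>t *\<^sub>R v\<close>, then along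
  \<open>v\<close> to the derivative so obtained. The point \<open>p\<close> depends on the order of
  \<open>u\<close> and \<open>v\<close>; only its distance to \<open>x\<close> is
  controlled.\<close>

lemma second_difference_mvt:
  fixes f :: "'a::real_normed_vector \<Rightarrow> real"
    and f' :: "'a \<Rightarrow> 'a \<Rightarrow>\<^sub>L real" and f'' :: "'a \<Rightarrow> 'a \<Rightarrow>\<^sub>L 'a \<Rightarrow>\<^sub>L real"
  assumes f': "\<And>x. (f has_derivative blinfun_apply (f' x)) (at x)"
    and f'': "\<And>x. (f' has_derivative blinfun_apply (f'' x)) (at x)"
    and t: "0 < t"
  obtains p where "norm (p - x) \<le> t * (norm u + norm v)"
    and "f (x + t *\<^sub>R u + t *\<^sub>R v) - f (x + t *\<^sub>R u) - f (x + t *\<^sub>R v) + f x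
           = t\<^sup>2 * blinfun_apply (blinfun_apply (f'' p) v) u"
proof -
  define \<phi> where "\<phi> = (\<lambda>s. f (x + s *\<^sub>R u + t *\<^sub>R v) - f (x + s *\<^sub>R u))"
  have line: "((\<lambda>s. f (y + s *\<^sub>R u)) has_real_derivative blinfun_apply (f' (y + s *\<^sub>R u)) u) (at s)"
    for y s
  proof -
    have "((\<lambda>s. y + s *\<^sub>R u) has_derivative (\<lambda>r. r *\<^sub>R u)) (at s)"
      by (auto intro!: derivative_eq_intros)
    from has_derivative_compose[OF this f']
    show ?thesis by (simp add: has_field_derivative_def blinfun.scaleR_right mult_commute_abs)
  qed
  have "(\<phi> has_real_derivative
      blinfun_apply (f' (x + s *\<^sub>R u + t *\<^sub>R v)) u - blinfun_apply (f' (x + s *\<^sub>R u)) u) (at s)" for s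
    unfolding \<phi>_def using DERIV_diff[OF line[of "x + t *\<^sub>R v" s] line[of x s]]
    by (simp add: algebra_simps)
  from MVT2[OF t this] obtain \<xi> where \<xi>: "0 < \<xi>" "\<xi> < t"
    and 1: "\<phi> t - \<phi> 0 = t * (blinfun_apply (f' (x + \<xi> *\<^sub>R u + t *\<^sub>R v)) u
                - blinfun_apply (f' (x + \<xi> *\<^sub>R u)) u)" by auto
  define \<psi> where "\<psi> = (\<lambda>r. blinfun_apply (f' (x + \<xi> *\<^sub>R u + r *\<^sub>R v)) u)"
  have "(\<psi> has_real_derivative
      blinfun_apply (blinfun_apply (f'' (x + \<xi> *\<^sub>R u + r *\<^sub>R v)) v) u) (at r)" for r
  proof -
    have "((\<lambda>r. x + \<xi> *\<^sub>R u + r *\<^sub>R v) has_derivative (\<lambda>r. r *\<^sub>R v)) (at r)"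
      by (auto intro!: derivative_eq_intros)
    from has_derivative_compose[OF this f'']
    have "((\<lambda>r. f' (x + \<xi> *\<^sub>R u + r *\<^sub>R v)) has_derivative
        (\<lambda>s. s *\<^sub>R blinfun_apply (f'' (x + \<xi> *\<^sub>R u + r *\<^sub>R v)) v)) (at r)"
      by (simp add: blinfun.scaleR_right)
    then have "(\<psi> has_derivative
        (\<lambda>s. s * blinfun_apply (blinfun_apply (f'' (x + \<xi> *\<^sub>R u + r *\<^sub>R v)) v) u)) (at r)"
      unfolding \<psi>_def by (auto intro!: derivative_eq_intros simp: blinfun.bilinear_simps)
    then show ?thesis by (simp add: has_field_derivative_def mult_commute_abs)
  qed
  from MVT2[OF t this] obtain \<eta> where \<eta>: "0 < \<eta>" "\<eta> < t"
    and 2: "\<psi> t - \<psi> 0 = t * blinfun_apply (blinfun_apply (f'' (x + \<xi> *\<^sub>R u + \<eta> *\<^sub>R v)) v) u" by auto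
  show thesis
  proof
    have "norm (\<xi> *\<^sub>R u + \<eta> *\<^sub>R v) \<le> \<xi> * norm u + \<eta> * norm v"
      using norm_triangle_ineq[of "\<xi> *\<^sub>R u" "\<eta> *\<^sub>R v"] \<xi> \<eta> by simp
    also have "\<dots> \<le> t * norm u + t * norm v"
      using \<xi> \<eta> by (intro add_mono mult_right_mono) auto
    finally show "norm ((x + \<xi> *\<^sub>R u + \<eta> *\<^sub>R v) - x) \<le> t * (norm u + norm v)"
      by (simp add: algebra_simps)
    show "f (x + t *\<^sub>R u + t *\<^sub>R v) - f (x + t *\<^sub>R u) - f (x + t *\<^sub>R v) + f x
        = t\<^sup>2 * blinfun_apply (blinfun_apply (f'' (x + \<xi> *\<^sub>R u + \<eta> *\<^sub>R v)) v) u"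
      using 1 2 by (simp add: \<phi>_def \<psi>_def power2_eq_square)
  qed
qed

text \<open>The second difference is symmetric in \<open>u\<close> and \<open>v\<close>, so
  evaluating it in both orders equates Hessian values at two points near \<open>x\<close>;
  continuity of \<open>f''\<close> carries the equality to \<open>x\<close>.\<close>

lemma hessian_form_commute:
  fixes f :: "'a::real_normed_vector \<Rightarrow> real"
  assumes "C2 f"
  shows "hessian_form f x u v = hessian_form f x v u"
proof -
  obtain f' f''
    where f': "\<And>x. (f has_derivative blinfun_apply (f' x)) (at x)"
      and f'': "\<And>x. (f' has_derivative blinfun_apply (f'' x)) (at x)"
      and cont: "continuous_on UNIV f''"
      and hess: "\<And>x w v. hessian_form f x w v = blinfun_apply (blinfun_apply (f'' x) w) v"
    using C2_hessian[OF assms] by blast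
  \<comment> \<open>The filter \<open>nhds x\<close>, unlike \<open>at x\<close>, includes
    \<open>x\<close> itself, which a mean value point may equal.\<close>
  have lim: "((\<lambda>y. hessian_form f y w z) \<longlongrightarrow> hessian_form f x w z) (nhds x)" for w z
    unfolding hess using cont
    by (intro tendsto_intros) (simp add: continuous_on_eq_continuous_within isCont_def tendsto_at_iff_tendsto_nhds)
  have "\<bar>hessian_form f x u v - hessian_form f x v u\<bar> \<le> e" if e: "0 < e" for e
  proof -
    have "\<forall>\<^sub>F y in nhds x. \<bar>hessian_form f y u v - hessian_form f x u v\<bar> < e / 2 \<and>
        \<bar>hessian_form f y v u - hessian_form f x v u\<bar> < e / 2"
      using tendstoD[OF lim[of u v], of "e / 2"] tendstoD[OF lim[of v u], of "e / 2"] e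
      by (simp add: dist_real_def eventually_conj_iff)
    then obtain d where d: "0 < d"
      and near: "\<And>y. dist y x < d \<Longrightarrow> \<bar>hessian_form f y u v - hessian_form f x u v\<bar> < e / 2 \<and>
        \<bar>hessian_form f y v u - hessian_form f x v u\<bar> < e / 2"
      unfolding eventually_nhds_metric by blast
    \<comment> \<open>Both mean value points then lie within \<open>d\<close> of \<open>x\<close>;
      the summand 1 keeps the denominator positive when \<open>u\<close> and \<open>v\<close>
      vanish.\<close>
    define t where "t = d / (2 * (norm u + norm v + 1))"
    have pos: "0 < norm u + norm v + 1" by (smt (verit) norm_ge_zero)
    have t: "0 < t" using d pos by (simp add: t_def)
    have "t * (norm u + norm v) < t * (2 * (norm u + norm v + 1))"
      using t pos by (intro mult_strict_left_mono) auto
    also have "\<dots> = d" using pos by (simp add: t_def)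
    finally have td: "t * (norm u + norm v) < d" .
    obtain p where p: "norm (p - x) \<le> t * (norm u + norm v)"
      and p': "f (x + t *\<^sub>R u + t *\<^sub>R v) - f (x + t *\<^sub>R u) - f (x + t *\<^sub>R v) + f x
           = t\<^sup>2 * hessian_form f p v u"
      unfolding hess using second_difference_mvt[OF f' f'' t] .
    obtain q where q: "norm (q - x) \<le> t * (norm v + norm u)"
      and q': "f (x + t *\<^sub>R v + t *\<^sub>R u) - f (x + t *\<^sub>R v) - f (x + t *\<^sub>R u) + f x
           = t\<^sup>2 * hessian_form f q u v"
      unfolding hess using second_difference_mvt[OF f' f'' t] .
    have "t\<^sup>2 * hessian_form f p v u = t\<^sup>2 * hessian_form f q u v"
      unfolding p'[symmetric] q'[symmetric] by (simp add: algebra_simps)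
    then have "hessian_form f p v u = hessian_form f q u v" using t by simp
    moreover have "dist p x < d" "dist q x < d" using p q td by (auto simp: dist_norm add.commute)
    ultimately show ?thesis using near[of p] near[of q] by linarith
  qed
  then have "\<bar>hessian_form f x u v - hessian_form f x v u\<bar> \<le> 0"
    by (rule field_le_epsilon[of _ 0, simplified])
  then show ?thesis by simp
qed

text \<open>The gradient vanishes along \<open>M\<close>, because every point of \<open>M\<close> minimizes \<open>f\<close>; differentiating it
  along a curve in \<open>M\<close> gives the claim.\<close>

lemma hessian_form_tangent_eq_0:
  fixes f :: "'a::real_normed_vector \<Rightarrow> real"
  assumes C2: "C2 f" and min: "\<And>y z. y \<in> M \<Longrightarrow> f y \<le> f z"
    and e: "0 < e" and \<gamma>: "\<gamma> ` {-e<..<e} \<subseteq> M" "(\<gamma> has_vector_derivative w) (at 0)"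
  shows "hessian_form f (\<gamma> 0) w v = 0"
proof -
  obtain f' f''
    where f': "\<And>x. (f has_derivative blinfun_apply (f' x)) (at x)"
      and f'': "\<And>x. (f' has_derivative blinfun_apply (f'' x)) (at x)"
      and hess: "\<And>x w v. hessian_form f x w v = blinfun_apply (blinfun_apply (f'' x) w) v"
    using C2_hessian[OF C2] by metis
  have crit: "f' y = 0" if "y \<in> M" for y
    using differential_zero_maxmin[OF _ open_UNIV f', of y] min[OF that]
    by (auto intro: blinfun_eqI)
  have "((\<lambda>t. f' (\<gamma> t)) has_vector_derivative blinfun_apply (f'' (\<gamma> 0)) w) (at 0)"
    using has_derivative_compose[OF \<gamma>(2)[unfolded has_vector_derivative_def] f'']
    by (simp add: has_vector_derivative_def blinfun.scaleR_right)
  moreover have "((\<lambda>t. f' (\<gamma> t)) has_vector_derivative 0) (at 0)"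
    by (rule has_vector_derivative_transform_within_open[of "\<lambda>_. 0" _ _ "{-e<..<e}"])
      (use e \<gamma>(1) crit in \<open>auto simp: image_subset_iff\<close>)
  ultimately have "blinfun_apply (f'' (\<gamma> 0)) w = 0"
    by (rule vector_derivative_unique_at)
  then show ?thesis by (simp add: hess)
qed

section \<open>Orthogonal projection and extremal eigenvalues on a subspace\<close>

lemma orth_proj:
  fixes v :: "'a::euclidean_space"
  assumes W: "subspace W"
  shows orth_proj_in: "orth_proj W v \<in> W"
    and inner_orth_proj: "w \<in> W \<Longrightarrow> inner w (orth_proj W v) = inner w v"
    and norm_orth_proj_le: "norm (orth_proj W v) \<le> norm v"
proof -
  obtain y z where y: "y \<in> span W" and z: "\<And>w. w \<in> span W \<Longrightarrow> orthogonal z w" and v: "v = y + z"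
    using orthogonal_subspace_decomp_exists[of W v] by blast
  have sp: "span W = W" using W by simp
  have "v - y \<in> orthogonal_comp W"
    using z v by (auto simp: orthogonal_comp_def sp orthogonal_commute)
  then have P: "orth_proj W v = y"
    using orth_proj_unique[OF W] y sp by simp
  show in_W: "orth_proj W v \<in> W" using P y sp by simp
  show inner: "inner w (orth_proj W v) = inner w v" if "w \<in> W" for w
    unfolding P using z[of w] that by (simp add: sp v inner_add_right orthogonal_def inner_commute)
  have "(norm y)\<^sup>2 = inner y v" using inner[OF in_W] by (simp add: P power2_norm_eq_inner)
  also have "\<dots> \<le> norm y * norm v" by (rule norm_cauchy_schwarz)
  finally show "norm (orth_proj W v) \<le> norm v"
    by (cases "y = 0") (auto simp: P power2_eq_square)
qed

text \<open>Eigenvectors of distinct eigenvalues are orthogonal, and a Euclidean space holds only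
  finitely many pairwise orthogonal vectors. Finiteness gives \<open>Min\<close> and
  \<open>Max\<close> of the spectrum their meaning.\<close>

lemma finite_eigenvalues_on:
  fixes T :: "'a::euclidean_space \<Rightarrow> 'a"
  assumes sym: "\<And>x y. x \<in> W \<Longrightarrow> y \<in> W \<Longrightarrow> inner x (T y) = inner (T x) y"
  shows "finite (eigenvalues_on T W)"
proof -
  have "\<forall>\<mu>\<in>eigenvalues_on T W. \<exists>v. v \<in> W \<and> v \<noteq> 0 \<and> T v = \<mu> *\<^sub>R v"
    by (auto simp: eigenvalues_on_def)
  then obtain b where b: "\<And>\<mu>. \<mu> \<in> eigenvalues_on T W \<Longrightarrow> b \<mu> \<in> W \<and> b \<mu> \<noteq> 0 \<and> T (b \<mu>) = \<mu> *\<^sub>R b \<mu>"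
    by metis
  have orth: "orthogonal (b \<mu>) (b \<nu>)"
    if "\<mu> \<in> eigenvalues_on T W" "\<nu> \<in> eigenvalues_on T W" "\<mu> \<noteq> \<nu>" for \<mu> \<nu>
    using sym[of "b \<mu>" "b \<nu>"] b[of \<mu>] b[of \<nu>] that by (simp add: orthogonal_def)
  have "inj_on b (eigenvalues_on T W)"
    using orth b by (metis inj_onI orthogonal_self)
  moreover have "finite (b ` eigenvalues_on T W)"
  proof (rule pairwise_orthogonal_imp_finite)
    show "pairwise orthogonal (b ` eigenvalues_on T W)"
      using orth unfolding pairwise_def by blast
  qed
  ultimately show ?thesis by (rule finite_imageD[rotated])
qed

text \<open>A maximizer \<open>x\<close> of the quadratic form on the compact unit sphere of
  \<open>W\<close> is an eigenvector: otherwise moving it along the residual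
  \<open>T x - \<mu> *\<^sub>R x\<close> would raise the Rayleigh quotient.\<close>

lemma Rayleigh_max_eigenvalue:
  fixes T :: "'a::euclidean_space \<Rightarrow> 'a"
  assumes W: "subspace W" "W \<noteq> {0}" and T: "linear T" "T ` W \<subseteq> W"
    and sym: "\<And>x y. x \<in> W \<Longrightarrow> y \<in> W \<Longrightarrow> inner x (T y) = inner (T x) y"
  obtains \<mu> where "\<mu> \<in> eigenvalues_on T W" and "\<And>x. x \<in> W \<Longrightarrow> inner x (T x) \<le> \<mu> * (norm x)\<^sup>2"
proof -
  interpret T: linear T by (rule T)
  have cont: "continuous_on S (\<lambda>x. inner x (T x))" for S
    by (intro continuous_intros linear_continuous_on) (simp add: T linear_conv_bounded_linear[symmetric])
  obtain a where a: "a \<in> W" "a \<noteq> 0" using W subspace_0 by blast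
  then have "sgn a \<in> sphere 0 1 \<inter> W"
    using W by (simp add: sgn_div_norm subspace_scale)
  then obtain x where x: "x \<in> W" "norm x = 1"
    and mx: "\<And>y. y \<in> W \<Longrightarrow> norm y = 1 \<Longrightarrow> inner y (T y) \<le> inner x (T x)"
    using continuous_attains_sup[of "sphere 0 1 \<inter> W", OF _ _ cont] W(1)
    by (force simp: compact_Int_closed closed_subspace)
  define \<mu> where "\<mu> = inner x (T x)"
  have bound: "inner y (T y) \<le> \<mu> * (norm y)\<^sup>2" if "y \<in> W" for y
  proof (cases "y = 0")
    case False
    have "inner (sgn y) (T (sgn y)) \<le> \<mu>"
      unfolding \<mu>_def using that W(1) False by (intro mx) (simp_all add: sgn_div_norm subspace_scale norm_sgn)
    then show ?thesis
      using False by (simp add: sgn_div_norm T.scale field_simps power2_eq_square)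
  qed (simp add: T.zero)
  define w where "w = T x - \<mu> *\<^sub>R x"
  have w: "w \<in> W" using x T W(1) by (auto simp: w_def intro!: subspace_diff subspace_scale)
  have xx: "inner x x = 1" using x by (simp add: dot_square_norm)
  \<comment> \<open>This is \<open>bound\<close> at \<open>x + t *\<^sub>R w\<close>: the terms of
    order zero cancel because \<open>x\<close> is a unit vector attaining \<open>\<mu>\<close>, and
    the rest is divided by \<open>t\<close>.\<close>
  have quad: "2 * inner w w \<le> t * (\<mu> * (norm w)\<^sup>2 - inner w (T w))" if "0 < t" for t
  proof -
    have "inner (x + t *\<^sub>R w) (T (x + t *\<^sub>R w)) \<le> \<mu> * inner (x + t *\<^sub>R w) (x + t *\<^sub>R w)"
      using bound[of "x + t *\<^sub>R w"] x w W(1)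
      by (simp add: subspace_add subspace_scale power2_norm_eq_inner)
    moreover have "inner x (T w) = inner (T x) w" using sym x w by blast
    ultimately have "2 * t * inner (T x - \<mu> *\<^sub>R x) w \<le> t * t * (\<mu> * inner w w - inner w (T w))"
      by (simp add: T.add T.scale algebra_simps inner_commute xx flip: \<mu>_def)
    then have "t * (2 * inner w w) \<le> t * (t * (\<mu> * inner w w - inner w (T w)))"
      by (simp add: w_def algebra_simps)
    then show ?thesis using that by (simp add: power2_norm_eq_inner)
  qed
  have "w = 0"
  proof (rule ccontr)
    assume "w \<noteq> 0"
    then have ww: "0 < inner w w" by simp
    define B where "B = \<mu> * (norm w)\<^sup>2 - inner w (T w)"
    have "0 < 2 * inner w w" by (rule mult_pos_pos[OF zero_less_numeral ww])
    also have "\<dots> \<le> B" using quad[OF zero_less_one] by (simp add: B_def)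
    finally have B: "0 < B" .
    \<comment> \<open>This choice of \<open>t\<close> makes the right side equal to
      \<open>inner w w\<close>, half of the left side.\<close>
    have "2 * inner w w \<le> inner w w / B * B"
      using quad[OF divide_pos_pos[OF ww B]] unfolding B_def[symmetric] .
    then show False using ww B by simp
  qed
  then have "T x = \<mu> *\<^sub>R x" by (simp add: w_def)
  then have "\<mu> \<in> eigenvalues_on T W" using x unfolding eigenvalues_on_def
    by (intro CollectI bexI[of _ x]) auto
  then show thesis using bound that by blast
qed

lemma Rayleigh_min_eigenvalue:
  fixes T :: "'a::euclidean_space \<Rightarrow> 'a"
  assumes W: "subspace W" "W \<noteq> {0}" and T: "linear T" "T ` W \<subseteq> W"
    and sym: "\<And>x y. x \<in> W \<Longrightarrow> y \<in> W \<Longrightarrow> inner x (T y) = inner (T x) y"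
  obtains \<mu> where "\<mu> \<in> eigenvalues_on T W" and "\<And>x. x \<in> W \<Longrightarrow> \<mu> * (norm x)\<^sup>2 \<le> inner x (T x)"
proof -
  obtain \<nu> where \<nu>: "\<nu> \<in> eigenvalues_on (\<lambda>x. - T x) W"
    and bound: "\<And>x. x \<in> W \<Longrightarrow> inner x (- T x) \<le> \<nu> * (norm x)\<^sup>2"
  proof (rule Rayleigh_max_eigenvalue[of W "\<lambda>x. - T x"])
    show "linear (\<lambda>x. - T x)" using T(1) by (rule linear_compose_neg)
    show "(\<lambda>x. - T x) ` W \<subseteq> W" using T(2) W(1) by (auto intro: subspace_neg)
  qed (use W sym in auto)
  show thesis
  proof
    show "- \<nu> \<in> eigenvalues_on T W"
      using \<nu> unfolding eigenvalues_on_def by (auto, metis minus_minus scaleR_minus_left)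
    show "- \<nu> * (norm x)\<^sup>2 \<le> inner x (T x)" if "x \<in> W" for x
      using bound[OF that] by simp
  qed
qed

section \<open>Frobenius pairings and bounds on inverse Gram matrices\<close>

lemma matrix_inv_mult:
  fixes A :: "real^'n^'n"
  assumes "invertible A"
  shows "A ** matrix_inv A = mat 1" and "matrix_inv A ** A = mat 1"
proof -
  have "A ** matrix_inv A = mat 1 \<and> matrix_inv A ** A = mat 1"
    unfolding matrix_inv_def using assms[unfolded invertible_def] by (rule someI_ex)
  then show "A ** matrix_inv A = mat 1" and "matrix_inv A ** A = mat 1" by auto
qed

text \<open>Identifies the Frobenius adjoint of a right multiplication; it turns pairings with
  \<open>g ** transpose g\<close> into squares of \<open>norm (Z ** g)\<close>.\<close>

lemma inner_matrix_mul_transpose: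
  fixes A B C :: "real^'n^'n"
  shows "inner (A ** C) B = inner A (B ** transpose C)"
proof -
  have "inner (A ** C) B = (\<Sum>i\<in>UNIV. \<Sum>j\<in>UNIV. \<Sum>k\<in>UNIV. A$i$k * C$k$j * B$i$j)"
    by (simp add: inner_vec_def matrix_matrix_mult_def sum_distrib_right)
  also have "\<dots> = (\<Sum>i\<in>UNIV. \<Sum>k\<in>UNIV. \<Sum>j\<in>UNIV. A$i$k * C$k$j * B$i$j)"
    by (rule sum.cong[OF refl], rule sum.swap)
  also have "\<dots> = inner A (B ** transpose C)"
    by (simp add: inner_vec_def matrix_matrix_mult_def sum_distrib_left transpose_def mult_ac)
  finally show ?thesis .
qed

lemma loewner_le_imp_inner_le:
  assumes "loewner_le A B"
  shows "inner x (A *v x) \<le> inner x (B *v x)"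
  using assms by (simp add: loewner_le_def psd_def matrix_vector_mult_diff_rdistrib inner_diff_right)

text \<open>The Frobenius pairing splits into one quadratic form per row of \<open>Y\<close>, and
  the Loewner order compares these forms row by row.\<close>

lemma loewner_le_mat_mult:
  fixes A B Y :: "real^'n^'n"
  assumes "loewner_le A B"
  shows "inner Y (Y ** A) \<le> inner Y (Y ** B)"
proof -
  have rows: "inner Y (Y ** C) = (\<Sum>i\<in>UNIV. inner (Y$i) (C *v Y$i))" for C
  proof -
    have "inner Y (Y ** C) = (\<Sum>i\<in>UNIV. inner (Y$i) (Y$i v* C))"
      by (simp add: inner_vec_def matrix_matrix_mult_def vector_matrix_mult_def mult_ac)
    also have "\<dots> = (\<Sum>i\<in>UNIV. inner (Y$i) (C *v Y$i))"
      by (simp add: dot_lmul_matrix inner_commute[of _ "_ v* _"])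
    finally show ?thesis .
  qed
  show ?thesis
    unfolding rows by (intro sum_mono loewner_le_imp_inner_le assms)
qed

text \<open>Writing \<open>A = Y ** g ** transpose g\<close> with \<open>Y = A ** N\<close> reduces
  both bounds on the inverse to bounds on the Gram matrix itself, combined with
  Cauchy-Schwarz.\<close>

lemma mult_matrix_inv_Gram_bounds:
  fixes g A :: "real^'n^'n"
  assumes g: "invertible g" and "0 < c" "0 < d"
    and lo: "loewner_le (c *\<^sub>R mat 1) (g ** transpose g)"
    and hi: "loewner_le (g ** transpose g) (d *\<^sub>R mat 1)"
  defines "N \<equiv> matrix_inv (g ** transpose g)"
  shows "c * norm (A ** N) \<le> norm A" and "(norm A)\<^sup>2 \<le> d * inner A (A ** N)"
proof -
  define Y where "Y = A ** N"
  have "invertible (g ** transpose g)"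
    using g by (simp add: invertible_mult transpose_invertible)
  from matrix_inv_mult(2)[OF this] have A: "A = Y ** g ** transpose g"
    by (simp add: Y_def N_def flip: matrix_mul_assoc)
  have scale: "Z ** (r *\<^sub>R mat 1) = r *\<^sub>R Z" for Z :: "real^'n^'n" and r
    by (simp add: vec_eq_iff matrix_matrix_mult_def mat_def if_distrib mult.commute cong: if_cong)
  have Gram: "inner Z (Z ** (g ** transpose g)) = (norm (Z ** g))\<^sup>2" for Z :: "real^'n^'n"
    by (simp add: power2_norm_eq_inner inner_matrix_mul_transpose matrix_mul_assoc)
  have AY: "inner A Y = (norm (Y ** g))\<^sup>2"
    using Gram[of Y] A by (simp add: matrix_mul_assoc inner_commute)
  have upper: "(norm (Z ** g))\<^sup>2 \<le> d * (norm Z)\<^sup>2" for Z :: "real^'n^'n"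
    using loewner_le_mat_mult[OF hi, of Z] by (simp add: Gram scale power2_norm_eq_inner)
  have "c * (norm Y)\<^sup>2 \<le> inner A Y"
    using loewner_le_mat_mult[OF lo, of Y] by (simp add: Gram AY scale power2_norm_eq_inner)
  also have "\<dots> \<le> norm A * norm Y" by (rule norm_cauchy_schwarz)
  finally show "c * norm (A ** N) \<le> norm A"
    by (cases "Y = 0") (auto simp: power2_eq_square simp flip: Y_def mult.assoc)
  let ?Z = "Y ** g"
  \<comment> \<open>One factor \<open>g\<close> is moved across the pairing, so that after squaring,
    \<open>norm ?Z\<close> yields \<open>inner A Y\<close> and \<open>norm (A ** g)\<close> is
    controlled by \<open>upper\<close>; one \<open>(norm A)\<^sup>2\<close> then cancels.\<close>
  have "(norm A)\<^sup>2 = inner ?Z (A ** g)"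
    by (metis A inner_commute inner_matrix_mul_transpose power2_norm_eq_inner)
  also have "\<dots> \<le> norm ?Z * norm (A ** g)" by (rule norm_cauchy_schwarz)
  finally have "((norm A)\<^sup>2)\<^sup>2 \<le> (norm ?Z * norm (A ** g))\<^sup>2" by (rule power_mono) simp
  also have "\<dots> \<le> (norm ?Z)\<^sup>2 * (d * (norm A)\<^sup>2)"
    unfolding power_mult_distrib using upper by (intro mult_left_mono) auto
  finally show "(norm A)\<^sup>2 \<le> d * inner A (A ** N)"
    unfolding AY[unfolded Y_def] by (cases "A = 0") (auto simp: power2_eq_square Y_def mult_ac)
qed

section \<open>Exponential stability from a quadratic Lyapunov function\<close>

text \<open>Since \<open>L\<close> is comparable to the squared norm, the decrease is a fixed
  fraction of \<open>L\<close>, so \<open>L\<close> decays geometrically and the norm decays at the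
  square root of that rate.\<close>

lemma exponentially_stable_quadratic_Lyapunov:
  fixes F :: "nat \<Rightarrow> 'a::real_normed_vector \<Rightarrow> 'a" and L :: "'a \<Rightarrow> real"
  assumes m: "0 < m" and \<delta>: "0 < \<delta>"
    and lower: "\<And>x. x \<in> W \<Longrightarrow> m * (norm x)\<^sup>2 \<le> L x"
    and upper: "\<And>x. x \<in> W \<Longrightarrow> L x \<le> M * (norm x)\<^sup>2"
    and decrease: "\<And>k x. x \<in> W \<Longrightarrow> F k x \<in> W \<Longrightarrow> L (F k x) \<le> L x - \<delta> * (norm x)\<^sup>2"
  shows "exponentially_stable W F"
proof -
  \<comment> \<open>If \<open>W\<close> has no nonzero vector, the bounds leave the sign of
    \<open>M\<close> open; the maximum makes \<open>K\<close> a safe divisor.\<close>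
  define K where "K = max M m"
  have K: "0 < K" "m \<le> K" "M \<le> K" using m by (auto simp: K_def)
  have upperK: "L x \<le> K * (norm x)\<^sup>2" if "x \<in> W" for x
    using upper[OF that] mult_right_mono[OF K(3), of "(norm x)\<^sup>2"] by simp
  \<comment> \<open>Truncation at 0 keeps \<open>sqrt q\<close> a valid rate should
    \<open>\<delta>\<close> exceed \<open>K\<close>.\<close>
  define q where "q = max 0 (1 - \<delta> / K)"
  have q: "0 \<le> q" "q < 1" using \<delta> K by (auto simp: q_def)
  have L0: "0 \<le> L x" if "x \<in> W" for x
    using lower[OF that] m by (meson mult_nonneg_nonneg order_trans less_imp_le zero_le_power2)
  have contraction: "L (F k x) \<le> q * L x" if "x \<in> W" "F k x \<in> W" for k x
  proof -
    have "\<delta> / K * L x \<le> \<delta> / K * (K * (norm x)\<^sup>2)"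
      using upperK[OF that(1)] \<delta> K by (intro mult_left_mono) auto
    then have "L (F k x) \<le> (1 - \<delta> / K) * L x"
      using decrease[OF that] K by (simp add: algebra_simps)
    also have "\<dots> \<le> q * L x" using L0 that by (intro mult_right_mono) (auto simp: q_def)
    finally show ?thesis .
  qed
  have "norm (x k) \<le> sqrt (K / m) * sqrt q ^ (k - k0) * norm (x k0)"
    if sol: "\<forall>k\<ge>k0. x k \<in> W \<and> x (Suc k) = F k (x k)" and k: "k0 \<le> k" for x k k0
  proof -
    have "L (x k) \<le> q ^ (k - k0) * L (x k0)"
      using k
    proof (induction rule: dec_induct)
      case (step n)
      \<comment> \<open>That \<open>F n (x n)\<close> lies in \<open>W\<close> is read off from the
        solution at time \<open>Suc n\<close>.\<close>
      have "L (x (Suc n)) \<le> q * L (x n)"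
        using contraction sol step.hyps by (metis le_SucI)
      also have "\<dots> \<le> q * (q ^ (n - k0) * L (x k0))"
        using step.IH q by (intro mult_left_mono)
      finally show ?case using step.hyps by (simp add: Suc_diff_le)
    qed simp
    moreover have "q ^ (k - k0) * L (x k0) \<le> q ^ (k - k0) * (K * (norm (x k0))\<^sup>2)"
      using sol q upperK by (intro mult_left_mono) auto
    moreover have "m * (norm (x k))\<^sup>2 \<le> L (x k)" using lower sol k by blast
    ultimately have "m * (norm (x k))\<^sup>2 \<le> q ^ (k - k0) * (K * (norm (x k0))\<^sup>2)" by linarith
    then have "(norm (x k))\<^sup>2 \<le> K / m * q ^ (k - k0) * (norm (x k0))\<^sup>2"
      using m by (simp add: field_simps)
    then have "sqrt ((norm (x k))\<^sup>2) \<le> sqrt (K / m * q ^ (k - k0) * (norm (x k0))\<^sup>2)"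
      by (rule real_sqrt_le_mono)
    then show ?thesis by (simp add: real_sqrt_mult real_sqrt_power real_sqrt_divide)
  qed
  then show ?thesis
    unfolding exponentially_stable_def using K m q
    by (intro exI[of _ "sqrt (K / m)"] conjI exI[of _ "sqrt q"]) auto
qed

section \<open>Lyapunov decrease for the projected system\<close>

theorem theorem3:
  fixes G :: "(real^'n^'n) set"
    and V :: "real^'n^'n \<Rightarrow> real"
    and g0 :: "real \<Rightarrow> real^'n^'n"
    and h \<alpha> c_lo c_hi lam_min lam_max :: real
  defines "W \<equiv> orthogonal_comp (Lie_algebra G)"
  defines "H \<equiv> hessian_op V (mat 1)"
  defines "lam_min \<equiv> Min (eigenvalues_on H W)"
    and "lam_max \<equiv> Max (eigenvalues_on H W)"
  assumes "matrix_Lie_group G"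
    and "C2 V"
    and "\<forall>x. 0 \<le> V x"
    and A_i: "V -` {0} = G"
    and A_ii: "\<forall>x. \<forall>g\<in>G. V (x ** g) = V x"
    and A_iii: "\<forall>y\<in>W - {0}. 0 < hessian_form V (mat 1) y y"
    and "0 < h" and "0 < \<alpha>"
    and "\<forall>t\<ge>0. g0 t \<in> G"
    and "0 < c_lo" and "c_lo \<le> c_hi"
    and B: "\<forall>t\<ge>0. loewner_le (c_lo *\<^sub>R mat 1) (g0 t ** transpose (g0 t)) \<and>
                  loewner_le (g0 t ** transpose (g0 t)) (c_hi *\<^sub>R mat 1)"
    and "0 < \<alpha> * h"
    and "\<alpha> * h < 2 * lam_min * c_lo\<^sup>2 / (lam_max\<^sup>2 * c_hi)"
  shows "exponentially_stable W
           (\<lambda>k v. v - (h * \<alpha>) *\<^sub>R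
              orth_proj W (H v ** matrix_inv (g0 (real k * h) ** transpose (g0 (real k * h)))))"
proof (cases "W = {0}")
  \<comment> \<open>Here the set of eigenvalues is empty and \<open>Min\<close> and
    \<open>Max\<close> carry no information, but every solution is zero.\<close>
  case True
  show ?thesis
    unfolding exponentially_stable_def True
    by (intro exI[of _ 1] conjI exI[of _ 0]) (auto dest: spec)
next
  case False
  have W: "subspace W" unfolding W_def by (rule subspace_orthogonal_comp)
  have inner_H: "inner w (H v) = hessian_form V (mat 1) w v" for w v
    unfolding H_def using \<open>C2 V\<close> by (rule inner_hessian_op)
  have sym: "inner w (H v) = inner (H w) v" for w v
    using hessian_form_commute[OF \<open>C2 V\<close>] by (metis inner_H inner_commute)
  \<comment> \<open>Self-adjointness moves \<open>H\<close> onto the test vector, where additivity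
    and homogeneity are those of the inner product.\<close>
  have "linear H"
    by (intro linearI) (simp_all add: vector_eq_ldot[symmetric] sym inner_add_right)
  then interpret H: linear H .
  have H_W: "H v \<in> W" for v
  proof -
    \<comment> \<open>Points of \<open>G\<close> are global minimizers, as \<open>V\<close> is
      nonnegative and vanishes there; the curve representing \<open>w\<close> thus annihilates the
      Hessian in its first slot, for every \<open>v\<close>.\<close>
    have "inner w (H v) = 0" if w: "w \<in> Lie_algebra G" for w
    proof -
      obtain \<gamma> e where "0 < e" "\<gamma> ` {-e<..<e} \<subseteq> G" "\<gamma> 0 = mat 1"
        "(\<gamma> has_vector_derivative w) (at 0)"
        using w by (auto simp: Lie_algebra_def)
      moreover have "V y \<le> V z" if "y \<in> G" for y z
        using that \<open>\<forall>x. 0 \<le> V x\<close> A_i by (auto simp: vimage_def)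
      ultimately show ?thesis
        using hessian_form_tangent_eq_0[OF \<open>C2 V\<close>, of G e \<gamma> w v] by (simp add: inner_H)
    qed
    then show ?thesis by (simp add: W_def orthogonal_comp_def orthogonal_def)
  qed
  have fin: "finite (eigenvalues_on H W)"
    using sym by (rule finite_eigenvalues_on)
  have eig_pos: "0 < \<mu>" if \<mu>: "\<mu> \<in> eigenvalues_on H W" for \<mu>
  proof -
    obtain v where v: "v \<in> W" "v \<noteq> 0" "H v = \<mu> *\<^sub>R v" using \<mu> by (auto simp: eigenvalues_on_def)
    then have "0 < \<mu> * inner v v" using A_iii inner_H[of v v] by simp
    moreover have "0 < inner v v" using v by simp
    ultimately show ?thesis by (rule zero_less_mult_pos2)
  qed
  obtain \<mu> where \<mu>: "\<mu> \<in> eigenvalues_on H W"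
    and lower: "\<And>x. x \<in> W \<Longrightarrow> \<mu> * (norm x)\<^sup>2 \<le> inner x (H x)"
    using Rayleigh_min_eigenvalue[OF W False \<open>linear H\<close>] H_W sym by blast
  obtain \<nu> where \<nu>: "\<nu> \<in> eigenvalues_on H W"
    and upper: "\<And>x. x \<in> W \<Longrightarrow> inner x (H x) \<le> \<nu> * (norm x)\<^sup>2"
    using Rayleigh_max_eigenvalue[OF W False \<open>linear H\<close>] H_W sym by blast
  have \<mu>0: "0 < \<mu>" using eig_pos \<mu> .
  have "lam_max \<in> eigenvalues_on H W" unfolding lam_max_def using fin \<mu> by (intro Max_in) auto
  then have max0: "0 < lam_max" by (rule eig_pos)
  have min_max: "lam_min \<le> lam_max"
    unfolding lam_min_def lam_max_def using fin \<mu> by (meson Max_ge Min_le order_trans)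
  have "\<nu> \<le> lam_max" unfolding lam_max_def using fin \<nu> by (rule Max_ge)
  then have upper': "inner x (H x) \<le> lam_max * (norm x)\<^sup>2" if "x \<in> W" for x
    using upper[OF that] by (meson mult_right_mono order_trans zero_le_power2)
  have c_hi: "0 < c_hi" using \<open>0 < c_lo\<close> \<open>c_lo \<le> c_hi\<close> by simp
  define a where "a = h * \<alpha>"
  have a: "0 < a" using \<open>0 < \<alpha> * h\<close> by (simp add: a_def mult.commute)
  \<comment> \<open>One step lowers the Lyapunov function by at least
    \<open>a * \<kappa> * (norm (H x))\<^sup>2\<close>: \<open>2 / c_hi\<close> comes from the term
    linear in \<open>a\<close>, the subtracted part from the quadratic one.\<close>
  define \<kappa> where "\<kappa> = 2 / c_hi - a * lam_max / c_lo\<^sup>2"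
  \<comment> \<open>As \<open>lam_min \<le> lam_max\<close>, the step size bound gives \<open>a < 2 c_lo\<^sup>2 / (lam_max c_hi)\<close>,
      which is all the argument needs.\<close>
  have "a * (lam_max\<^sup>2 * c_hi) < 2 * lam_min * c_lo\<^sup>2"
    using \<open>\<alpha> * h < _\<close> max0 c_hi by (simp add: a_def pos_less_divide_eq mult.commute[of h])
  also have "\<dots> \<le> 2 * lam_max * c_lo\<^sup>2" using min_max by (intro mult_right_mono) auto
  finally have "lam_max * (a * lam_max * c_hi) < lam_max * (2 * c_lo\<^sup>2)"
    by (simp add: power2_eq_square mult_ac)
  then have "a * lam_max * c_hi < 2 * c_lo\<^sup>2" using max0 by simp
  then have \<kappa>: "0 < \<kappa>" using c_hi \<open>0 < c_lo\<close> by (simp add: \<kappa>_def field_simps)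
  show ?thesis
    unfolding a_def[symmetric]
  \<comment> \<open>The factor \<open>\<mu>\<^sup>2\<close> in \<open>\<delta>\<close> converts
    \<open>norm (H x)\<close> into \<open>norm x\<close>, via
    \<open>\<mu> * norm x \<le> norm (H x)\<close>.\<close>
  proof (rule exponentially_stable_quadratic_Lyapunov[where L = "\<lambda>x. inner x (H x)"
        and m = \<mu> and M = lam_max and \<delta> = "a * \<kappa> * \<mu>\<^sup>2"])
    show "0 < a * \<kappa> * \<mu>\<^sup>2" using a \<kappa> \<mu>0 by simp
    fix k x assume x: "x \<in> W"
    define g where "g = g0 (real k * h)"
    define N where "N = matrix_inv (g ** transpose g)"
    define p where "p = orth_proj W (H x ** N)"
    have time: "0 \<le> real k * h" using \<open>0 < h\<close> by simp
    have "g \<in> G" using \<open>\<forall>t\<ge>0. g0 t \<in> G\<close> time by (simp add: g_def)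
    then have "invertible g" using \<open>matrix_Lie_group G\<close> by (auto simp: matrix_Lie_group_def)
    note bounds = mult_matrix_inv_Gram_bounds[OF this \<open>0 < c_lo\<close> c_hi, of "H x", folded N_def]
    have lo: "c_lo * norm (H x ** N) \<le> norm (H x)"
      and hi: "(norm (H x))\<^sup>2 \<le> c_hi * inner (H x) (H x ** N)"
      using bounds B time by (auto simp: g_def)
    \<comment> \<open>Because \<open>H x\<close> lies in \<open>W\<close>, pairing with it removes
      the projection.\<close>
    have p: "p \<in> W" and "inner (H x) p = inner (H x) (H x ** N)" and "norm p \<le> norm (H x ** N)"
      using orth_proj[OF W] H_W by (auto simp: p_def)
    have first: "(norm (H x))\<^sup>2 / c_hi \<le> inner (H x) p"
      using hi c_hi \<open>inner (H x) p = _\<close> by (simp add: pos_divide_le_eq mult.commute)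
    have "norm p \<le> norm (H x) / c_lo"
      using lo \<open>norm p \<le> _\<close> \<open>0 < c_lo\<close> by (simp add: pos_le_divide_eq mult.commute)
        (meson mult_left_mono less_imp_le order_trans)
    then have "(norm p)\<^sup>2 \<le> (norm (H x) / c_lo)\<^sup>2" by (rule power_mono) simp
    then have "lam_max * (norm p)\<^sup>2 \<le> lam_max * (norm (H x) / c_lo)\<^sup>2"
      using max0 by (intro mult_left_mono) auto
    with upper'[OF p] have second: "inner p (H p) \<le> lam_max * (norm (H x))\<^sup>2 / c_lo\<^sup>2"
      by (simp add: power_divide)
    have "\<mu> * (norm x)\<^sup>2 \<le> norm x * norm (H x)"
      using lower[OF x] norm_cauchy_schwarz[of x "H x"] by linarith
    then have "\<mu> * norm x \<le> norm (H x)"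
      by (cases "x = 0") (auto simp: power2_eq_square)
    then have "(\<mu> * norm x)\<^sup>2 \<le> (norm (H x))\<^sup>2" using \<mu>0 by (intro power_mono) auto
    then have "a * \<kappa> * (\<mu>\<^sup>2 * (norm x)\<^sup>2) \<le> a * \<kappa> * (norm (H x))\<^sup>2"
      using a \<kappa> by (intro mult_left_mono) (auto simp: power_mult_distrib)
    \<comment> \<open>The expansion is exact; self-adjointness merges the two cross terms.\<close>
    moreover have "inner (x - a *\<^sub>R p) (H (x - a *\<^sub>R p))
        = inner x (H x) - 2 * a * inner (H x) p + a * a * inner p (H p)"
      by (simp add: H.diff H.scale inner_diff_left inner_diff_right sym[of x p] inner_commute[of p "H x"]
          algebra_simps)
    moreover have "a * ((norm (H x))\<^sup>2 / c_hi) \<le> a * inner (H x) p"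
      using first a by (intro mult_left_mono) auto
    moreover have "a * a * inner p (H p) \<le> a * a * (lam_max * (norm (H x))\<^sup>2 / c_lo\<^sup>2)"
      using second a by (intro mult_left_mono) auto
    moreover have "a * \<kappa> * (norm (H x))\<^sup>2
        = 2 * (a * ((norm (H x))\<^sup>2 / c_hi)) - a * a * (lam_max * (norm (H x))\<^sup>2 / c_lo\<^sup>2)"
      by (simp add: \<kappa>_def algebra_simps)
    ultimately have "inner (x - a *\<^sub>R p) (H (x - a *\<^sub>R p)) \<le> inner x (H x) - a * \<kappa> * \<mu>\<^sup>2 * (norm x)\<^sup>2"
      by (simp add: mult.assoc)
    then show "inner (x - a *\<^sub>R orth_proj W (H x ** matrix_inv (g0 (real k * h) ** transpose (g0 (real k * h)))))
        (H (x - a *\<^sub>R orth_proj W (H x ** matrix_inv (g0 (real k * h) ** transpose (g0 (real k * h))))))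
        \<le> inner x (H x) - a * \<kappa> * \<mu>\<^sup>2 * (norm x)\<^sup>2"
      by (simp add: p_def N_def g_def)
  qed (use \<mu>0 lower upper' in auto)
qed

end
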